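(* Consider the $l$-th MGU layer, $l\in\{1,\dots,L\}$, with parameters $\theta^{(l)}=\{W_f^{(l)},W_{\tilde h}^{(l)},R_f^{(l)},R_{\tilde h}^{(l)},\boldsymbol b_f^{(l)},\boldsymbol b_{\tilde h}^{(l)}\}$, initial hidden state $\boldsymbol h_0^{(l)}\in\mathcal H_{\mathrm{inv}}^{(l)}=[-1,1]^{n_h^{(l)}}$ and inputs $\tilde{\boldsymbol u}_k^{(l)}\in\tilde{\mathcal U}^{(l)}=[-1,1]^{n_{\tilde u}^{(l)}}$ for all $k\in\mathbb N$. If $$\bar\sigma_f^{(l)}\,\|R_{\tilde h}^{(l)}\|<1,\qquad \bar\sigma_f^{(l)}:=\sigma\left(\left\|\begin{bmatrix}W_f^{(l)} & R_f^{(l)} & \boldsymbol b_f^{(l)}\end{bmatrix}\right\|\right),$$ then the layer is ISS in $\mathcal H_{\mathrm{inv}}^{(l)}$ with respect to $\tilde{\mathcal U}^{(l)}$.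
   Context: Notation: $\mathbb N$ includes $0$; $\|\cdot\|$ is the infinity norm of vectors and the induced infinity norm of matrices (maximum absolute row sum); $\circ$ is the element-wise product; $\sigma(x)=1/(1+e^{-x})$ and $\phi(x)=\tanh(x)$; bold $\boldsymbol\sigma,\boldsymbol\phi$ denote component-wise application; $\boldsymbol 1_n$ is the all-ones vector; $[A\ B\ C]$ is horizontal concatenation. MGU layer: with hidden state $\boldsymbol h_k^{(l)}\in\mathbb R^{n_h^{(l)}}$ and input $\tilde{\boldsymbol u}_k^{(l)}\in\mathbb R^{n_{\tilde u}^{(l)}}$, the dynamics are $$\boldsymbol f_k^{(l)}=\boldsymbol\sigma(W_f^{(l)}\tilde{\boldsymbol u}_k^{(l)}+R_f^{(l)}\boldsymbol h_k^{(l)}+\boldsymbol b_f^{(l)}),$$ $$\tilde{\boldsymbol h}_k^{(l)}=\boldsymbol\phi(W_{\tilde h}^{(l)}\tilde{\boldsymbol u}_k^{(l)}+R_{\tilde h}^{(l)}(\boldsymbol f_k^{(l)}\circ\boldsymbol h_k^{(l)})+\boldsymbol b_{\tilde h}^{(l)}),$$ $$\boldsymbol h_{k+1}^{(l)}=(\boldsymbol 1_{n_h^{(l)}}-\boldsymbol f_k^{(l)})\circ\boldsymbol h_k^{(l)}+\boldsymbol f_k^{(l)}\circ\tilde{\boldsymbol h}_k^{(l)},$$ where $W_f^{(l)},W_{\tilde h}^{(l)}\in\mathbb R^{n_h^{(l)}\times n_{\tilde u}^{(l)}}$, $R_f^{(l)},R_{\tilde h}^{(l)}\in\mathbb R^{n_h^{(l)}\times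 n_h^{(l)}}$, $\boldsymbol b_f^{(l)},\boldsymbol b_{\tilde h}^{(l)}\in\mathbb R^{n_h^{(l)}}$. Comparison functions: $\gamma:\mathbb R_{\ge0}\to\mathbb R_{\ge0}$ is class $\mathcal K$ if continuous, strictly increasing, $\gamma(0)=0$; class $\mathcal K_\infty$ if moreover $\gamma(r)\to\infty$ as $r\to\infty$. A continuous $\psi:\mathbb R_{\ge0}\times\mathbb N\to\mathbb R_{\ge0}$ is class $\mathcal{KL}$ if $\psi(\cdot,k)\in\mathcal K$ for each fixed $k$ and, for each fixed $r>0$, $\psi(r,k)$ is strictly decreasing to zero as $k\to\infty$. ISS (with bias term): a system $\boldsymbol x_{k+1}=\boldsymbol w(\boldsymbol x_k,\boldsymbol u_k)$ is ISS in a compact forward invariant set $\mathcal X$ with respect to a compact set $\mathcal U$ if there exist $\psi\in\mathcal{KL}$ and $\gamma_u,\gamma_b\in\mathcal K_\infty$ such that for any $k\in\mathbb N$, any $\boldsymbol x_0\in\mathcal X$, any inputs $\boldsymbol u_0,\dots,\boldsymbol u_{k-1}\in\mathcal U$, and any bias vector $\boldsymbol b$, $$\|\boldsymbol x_k\|\le\psi(\|\boldsymbol x_0\|,k)+\gamma_u\Big(\max_{0\le z<k}\|\boldsymbol u_z\|\Big)+\gamma_b(\|\boldsymbol b\|),$$ with the maximum over an empty set taken to be $0$. For the MGU layer, $\boldsymbol x_k=\boldsymbol h_k^{(l)}$, $\boldsymbol u_k=\tilde{\boldsymbol u}_k^{(l)}$, and the bias vector $\boldsymbol b$ is the bias $\boldsymbol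 b_{\tilde h}^{(l)}$ in the dynamics: the functions $\psi,\gamma_u,\gamma_b$ may depend on $W_f^{(l)},W_{\tilde h}^{(l)},R_f^{(l)},R_{\tilde h}^{(l)},\boldsymbol b_f^{(l)}$, and the bound holds for every value of $\boldsymbol b_{\tilde h}^{(l)}\in\mathbb R^{n_h^{(l)}}$. *)

theory Defs
  imports "HOL-Analysis.Analysis"
begin

section \<open>Comparison functions\<close>

text \<open>A function on \<open>[0, \<infinity>)\<close> is represented by a function on \<open>real\<close> of which only the
  values on \<open>{0..}\<close> are constrained and used.\<close>

definition class_K :: "(real \<Rightarrow> real) \<Rightarrow> bool" where
  "class_K \<gamma> \<longleftrightarrow>
     \<gamma> \<in> {0..} \<rightarrow> {0..} \<and> continuous_on {0..} \<gamma> \<and> strict_mono_on {0..} \<gamma> \<and> \<gamma> 0 = 0"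

definition class_K_inf :: "(real \<Rightarrow> real) \<Rightarrow> bool" where
  "class_K_inf \<gamma> \<longleftrightarrow> class_K \<gamma> \<and> filterlim \<gamma> at_top at_top"

definition class_KL :: "(real \<Rightarrow> nat \<Rightarrow> real) \<Rightarrow> bool" where
  "class_KL \<psi> \<longleftrightarrow>
     continuous_on ({0..} \<times> UNIV) (\<lambda>(r, k). \<psi> r k) \<and>
     (\<forall>k. class_K (\<lambda>r. \<psi> r k)) \<and>
     (\<forall>r>0. (\<forall>j k. j < k \<longrightarrow> \<psi> r k < \<psi> r j) \<and> \<psi> r \<longlonglongrightarrow> 0)"


section \<open>Input-to-state stability with a bias term\<close>

text \<open>A system is a map \<open>w\<close> with \<open>x\<^bsub>k+1\<^esub> = w b x\<^sub>k u\<^sub>k\<close>, where \<open>b\<close> is a constant bias.\<close>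

primrec trajectory :: "('x \<Rightarrow> 'u \<Rightarrow> 'x) \<Rightarrow> 'x \<Rightarrow> (nat \<Rightarrow> 'u) \<Rightarrow> nat \<Rightarrow> 'x" where
  "trajectory w x0 u 0 = x0"
| "trajectory w x0 u (Suc k) = w (trajectory w x0 u k) (u k)"

definition forward_invariant :: "('x \<Rightarrow> 'u \<Rightarrow> 'x) \<Rightarrow> 'x set \<Rightarrow> 'u set \<Rightarrow> bool" where
  "forward_invariant w X U \<longleftrightarrow> (\<forall>x\<in>X. \<forall>u\<in>U. w x u \<in> X)"

definition max_input :: "(nat \<Rightarrow> 'u::euclidean_space) \<Rightarrow> nat \<Rightarrow> real" where
  "max_input u k = (if k = 0 then 0 else Max ((\<lambda>z. infnorm (u z)) ` {..<k}))"

text \<open>The comparison functions are chosen before the bias, so they are uniform in it; the bias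
  ranges over its whole space. Compactness of the two sets and forward invariance (for every
  bias) are part of the notion.\<close>

definition ISS ::
  "('b::euclidean_space \<Rightarrow> 'x::euclidean_space \<Rightarrow> 'u::euclidean_space \<Rightarrow> 'x) \<Rightarrow> 'x set \<Rightarrow> 'u set \<Rightarrow> bool"
where
  "ISS w X U \<longleftrightarrow>
     compact X \<and> compact U \<and> (\<forall>b. forward_invariant (w b) X U) \<and>
     (\<exists>\<psi> \<gamma>\<^sub>u \<gamma>\<^sub>b. class_KL \<psi> \<and> class_K_inf \<gamma>\<^sub>u \<and> class_K_inf \<gamma>\<^sub>b \<and>
       (\<forall>k. \<forall>x0\<in>X. \<forall>u b. (\<forall>z<k. u z \<in> U) \<longrightarrow>
         infnorm (trajectory (w b) x0 u k)
           \<le> \<psi> (infnorm x0) k + \<gamma>\<^sub>u (max_input u k) + \<gamma>\<^sub>b (infnorm b)))"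


section \<open>Matrices\<close>

text \<open>The matrix norm induced by \<^const>\<open>infnorm\<close>, as the maximum absolute row sum.\<close>

definition mat_infnorm :: "real ^ 'm ^ 'n \<Rightarrow> real" where
  "mat_infnorm A = Max (range (\<lambda>i. \<Sum>j\<in>UNIV. \<bar>A $ i $ j\<bar>))"

text \<open>Horizontal concatenation; the columns are indexed by the disjoint sum of the index types.\<close>

definition hcat :: "real ^ 'a ^ 'n \<Rightarrow> real ^ 'b ^ 'n \<Rightarrow> real ^ ('a + 'b) ^ 'n" where
  "hcat A B = (\<chi> i j. case j of Inl p \<Rightarrow> A $ i $ p | Inr q \<Rightarrow> B $ i $ q)"


section \<open>The MGU layer\<close>

definition sigmoid :: "real \<Rightarrow> real" where
  "sigmoid x = 1 / (1 + exp (- x))"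

definition mgu_gate ::
  "real ^ 'm ^ 'n \<Rightarrow> real ^ 'n ^ 'n \<Rightarrow> real ^ 'n \<Rightarrow> real ^ 'n \<Rightarrow> real ^ 'm \<Rightarrow> real ^ 'n"
where
  "mgu_gate W\<^sub>f R\<^sub>f b\<^sub>f h u = (\<chi> i. sigmoid ((W\<^sub>f *v u + R\<^sub>f *v h + b\<^sub>f) $ i))"

text \<open>On \<open>real ^ 'n\<close>, \<open>(*)\<close> is the element-wise product and \<open>1\<close> the all-ones vector.\<close>

definition mgu_candidate ::
  "real ^ 'm ^ 'n \<Rightarrow> real ^ 'n ^ 'n \<Rightarrow> real ^ 'n \<Rightarrow> real ^ 'n \<Rightarrow> real ^ 'n \<Rightarrow> real ^ 'm \<Rightarrow> real ^ 'n"
where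
  "mgu_candidate W\<^sub>h R\<^sub>h b\<^sub>h f h u = (\<chi> i. tanh ((W\<^sub>h *v u + R\<^sub>h *v (f * h) + b\<^sub>h) $ i))"

definition mgu_step ::
  "real ^ 'm ^ 'n \<Rightarrow> real ^ 'm ^ 'n \<Rightarrow> real ^ 'n ^ 'n \<Rightarrow> real ^ 'n ^ 'n \<Rightarrow> real ^ 'n
    \<Rightarrow> real ^ 'n \<Rightarrow> real ^ 'n \<Rightarrow> real ^ 'm \<Rightarrow> real ^ 'n"
where
  "mgu_step W\<^sub>f W\<^sub>h R\<^sub>f R\<^sub>h b\<^sub>f b\<^sub>h h u =
     (let f = mgu_gate W\<^sub>f R\<^sub>f b\<^sub>f h u
      in (1 - f) * h + f * mgu_candidate W\<^sub>h R\<^sub>h b\<^sub>h f h u)"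

definition sigma_bar_f :: "real ^ 'm ^ 'n \<Rightarrow> real ^ 'n ^ 'n \<Rightarrow> real ^ 'n \<Rightarrow> real" where
  "sigma_bar_f W\<^sub>f R\<^sub>f b\<^sub>f =
     sigmoid (mat_infnorm (hcat (hcat W\<^sub>f R\<^sub>f) (columnvector b\<^sub>f :: real ^ 1 ^ 'n)))"

end

theory Submission
  imports Defs
begin

text \<open>
  Write \<open>s = sigma_bar_f\<close>, \<open>\<rho> = s * \<parallel>R\<^sub>h\<parallel> < 1\<close>. The gate's pre-activation is the concatenated matrix
  \<open>[W\<^sub>f R\<^sub>f b\<^sub>f]\<close> applied to the stacked vector \<open>(u, h, 1)\<close>, whose norm is at most 1 on the
  admissible sets. As \<open>sigmoid (- x) = 1 - sigmoid x\<close>, every gate component \<open>f\<^sub>i\<close> lies in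
  \<open>[1 - s, s]\<close> (\<open>mgu_gate_bounds\<close>). The two ends are used for different purposes.

  The upper end controls the candidate: since \<open>\<bar>tanh z\<bar> \<le> \<bar>z\<bar>\<close>, its norm is at most
  \<open>\<rho> * \<parallel>h\<parallel> + (\<parallel>W\<^sub>h\<parallel> * \<parallel>u\<parallel> + \<parallel>b\<^sub>h\<parallel>)\<close>. Let \<open>D\<close> be at least the fixed point of this affine
  bound, that is \<open>(1 - \<rho>) * D \<ge> \<parallel>W\<^sub>h\<parallel> * \<parallel>u\<parallel> + \<parallel>b\<^sub>h\<parallel>\<close>, and let \<open>H \<ge> D\<close> bound \<open>\<parallel>h\<parallel>\<close>. Each component of the new
  state is the convex combination, with weight \<open>f\<^sub>i\<close>, of a number of size at most \<open>H\<close> and one of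
  size at most \<open>\<rho> * H + (1 - \<rho>) * D\<close>; it is therefore at most
  \<open>H - f\<^sub>i * (1 - \<rho>) * (H - D)\<close> in size. The lower end of the gate range now shows that the excess
  over \<open>D\<close> shrinks by the uniform factor \<open>\<lambda> = 1 - (1 - s) * (1 - \<rho>) < 1\<close> (\<open>mgu_step_contracts\<close>).

  Such a contraction towards a level that is linear in \<open>\<parallel>u\<parallel>\<close> and \<open>\<parallel>b\<parallel>\<close> gives ISS with
  \<open>\<psi> r k = \<lambda>\<^sup>k * r\<close> and linear gains (\<open>ISS_if_contracts_to_linear_level\<close>). Invariance of the unit
  box holds because the new state is a componentwise convex combination of points of the box.
\<close>

section \<open>Linear comparison functions\<close>

lemma class_K_linear:
  fixes c :: real
  assumes "c > 0"
  shows "class_K (\<lambda>r. c * r)"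
  using assms unfolding class_K_def
  by (auto intro!: continuous_intros strict_mono_onI)

lemma class_K_inf_linear:
  fixes c :: real
  assumes "c > 0"
  shows "class_K_inf (\<lambda>r. c * r)"
  unfolding class_K_inf_def
  using class_K_linear[OF assms]
    filterlim_tendsto_pos_mult_at_top[OF tendsto_const assms filterlim_ident]
  by blast

lemma class_KL_geometric:
  fixes l :: real
  assumes l: "0 < l" "l < 1"
  shows "class_KL (\<lambda>r k. l ^ k * r)"
proof -
  have "continuous_on ({0..} \<times> UNIV) (\<lambda>p :: real \<times> nat. l ^ snd p)"
    by (rule continuous_on_compose2[of UNIV "\<lambda>k::nat. l ^ k"])
      (simp_all add: continuous_on_snd)
  then have "continuous_on ({0..} \<times> UNIV) (\<lambda>p :: real \<times> nat. l ^ snd p * fst p)"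
    by (intro continuous_on_mult continuous_on_fst continuous_on_id)
  then have "continuous_on ({0..} \<times> UNIV) (\<lambda>(r, k::nat). l ^ k * r)"
    by (simp add: case_prod_unfold)
  moreover have "(\<lambda>k. l ^ k * r) \<longlonglongrightarrow> 0" for r
    using tendsto_mult_left_zero[OF LIMSEQ_power_zero[of l]] l by simp
  ultimately show ?thesis
    unfolding class_KL_def using l by (auto intro: class_K_linear power_strict_decreasing)
qed

section \<open>ISS from a one-step contraction\<close>

lemma trajectory_in_invariant_set:
  assumes "forward_invariant w X U" "x0 \<in> X" "\<And>z. z < k \<Longrightarrow> u z \<in> U"
  shows "trajectory w x0 u k \<in> X"
  using assms(3)
  by (induction k) (use assms(1,2) in \<open>auto simp: forward_invariant_def\<close>)

lemma infnorm_le_max_input: "z < k \<Longrightarrow> infnorm (u z) \<le> max_input u k"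
  unfolding max_input_def by (auto intro!: Max_ge)

text \<open>
  The level \<open>D\<close> may change from step to step with the input, but replacing it by its largest
  value along the trajectory preserves the hypothesis, as the right-hand side is increasing
  in \<open>D\<close>. For a constant level the excess of the state norm over it decays geometrically.
\<close>

lemma ISS_if_contracts_to_linear_level:
  fixes w :: "'b::euclidean_space \<Rightarrow> 'x::euclidean_space \<Rightarrow> 'u::euclidean_space \<Rightarrow> 'x"
  assumes cpt: "compact X" "compact U"
    and inv: "\<And>b. forward_invariant (w b) X U"
    and l: "0 < l" "l < 1" and pos: "0 < cu" "0 < cb"
    and step: "\<And>b x u D. x \<in> X \<Longrightarrow> u \<in> U \<Longrightarrow> D = cu * infnorm u + cb * infnorm b \<Longrightarrow>
      infnorm (w b x u) \<le> l * max (infnorm x) D + (1 - l) * D"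
  shows "ISS w X U"
proof -
  have bound: "infnorm (trajectory (w b) x0 u k)
      \<le> l ^ k * infnorm x0 + cu * max_input u k + cb * infnorm b"
    if x0: "x0 \<in> X" and u: "\<forall>z<k. u z \<in> U" for k x0 u b
  proof -
    define E where "E = cu * max_input u k + cb * infnorm b"
    have "infnorm (trajectory (w b) x0 u j) \<le> l ^ j * infnorm x0 + E" if "j \<le> k" for j
      using that
    proof (induction j)
      case 0
      have "0 \<le> max_input u k"
        using infnorm_le_max_input[of 0 k u] infnorm_pos_le[of "u 0"]
        by (cases "k = 0") (simp add: max_input_def, linarith)
      then show ?case
        using pos infnorm_pos_le[of b] by (simp add: E_def)
    next
      case (Suc j)
      let ?x = "trajectory (w b) x0 u j"
      define D where "D = cu * infnorm (u j) + cb * infnorm b"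
      have "?x \<in> X"
        using trajectory_in_invariant_set[OF inv x0] u Suc.prems by simp
      then have "infnorm (w b ?x (u j)) \<le> l * max (infnorm ?x) D + (1 - l) * D"
        using step u Suc.prems D_def by simp
      also have DE: "D \<le> E"
        using infnorm_le_max_input[of j k u] Suc.prems pos by (simp add: D_def E_def)
      have "max (infnorm ?x) D \<le> l ^ j * infnorm x0 + E"
        using Suc DE l infnorm_pos_le[of x0] by (simp add: add_increasing)
      then have "l * max (infnorm ?x) D + (1 - l) * D
          \<le> l * (l ^ j * infnorm x0 + E) + (1 - l) * E"
        using DE l by (intro add_mono mult_left_mono) auto
      also have "\<dots> = l ^ Suc j * infnorm x0 + E"
        by (simp add: algebra_simps)
      finally show ?case by simp
    qed
    then show ?thesis by (simp add: E_def add.assoc)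
  qed
  show ?thesis
    unfolding ISS_def
    using cpt inv bound class_KL_geometric[OF l] class_K_inf_linear[OF pos(1)]
      class_K_inf_linear[OF pos(2)]
    by (intro conjI exI[of _ "\<lambda>r k. l ^ k * r"] exI[of _ "\<lambda>r. cu * r"] exI[of _ "\<lambda>r. cb * r"])
      auto
qed

section \<open>The infinity norm and the row-sum norm\<close>

lemma infnorm_le_iff_cart:
  fixes x :: "real ^ 'n"
  shows "infnorm x \<le> c \<longleftrightarrow> (\<forall>i. \<bar>x $ i\<bar> \<le> c)"
proof
  show "infnorm x \<le> c \<Longrightarrow> \<forall>i. \<bar>x $ i\<bar> \<le> c"
    using component_le_infnorm_cart[of x] order_trans by blast
  show "\<forall>i. \<bar>x $ i\<bar> \<le> c \<Longrightarrow> infnorm x \<le> c"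
    unfolding infnorm_cart by (intro cSup_least) auto
qed

lemma mem_unit_cbox_iff:
  fixes x :: "real ^ 'n"
  shows "x \<in> cbox (- 1) 1 \<longleftrightarrow> infnorm x \<le> 1"
  by (auto simp: mem_box_cart infnorm_le_iff_cart abs_le_iff minus_le_iff)

lemma mat_infnorm_row_sum: "(\<Sum>j\<in>UNIV. \<bar>A $ i $ j\<bar>) \<le> mat_infnorm A"
  unfolding mat_infnorm_def by (auto intro: Max_ge)

lemma mat_infnorm_nonneg: "0 \<le> mat_infnorm A"
  using mat_infnorm_row_sum[of A undefined] by (meson abs_ge_zero order_trans sum_nonneg)

lemma matrix_vector_component_le:
  fixes A :: "real ^ 'm ^ 'n"
  assumes "infnorm x \<le> c"
  shows "\<bar>(A *v x) $ i\<bar> \<le> mat_infnorm A * c"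
proof -
  have "\<bar>(A *v x) $ i\<bar> \<le> (\<Sum>j\<in>UNIV. \<bar>A $ i $ j * x $ j\<bar>)"
    by (simp add: matrix_vector_mult_def)
  also have "\<dots> \<le> (\<Sum>j\<in>UNIV. \<bar>A $ i $ j\<bar> * c)"
    using assms by (auto intro!: sum_mono mult_left_mono simp: abs_mult infnorm_le_iff_cart)
  also have "\<dots> \<le> mat_infnorm A * c"
    using mat_infnorm_row_sum[of A i] assms infnorm_pos_le[of x]
    by (simp add: sum_distrib_right[symmetric] mult_right_mono)
  finally show ?thesis .
qed

definition vstack :: "real ^ 'a \<Rightarrow> real ^ 'b \<Rightarrow> real ^ ('a + 'b)" where
  "vstack x y = (\<chi> j. case j of Inl p \<Rightarrow> x $ p | Inr q \<Rightarrow> y $ q)"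

lemma hcat_mult_vstack: "hcat A B *v vstack x y = A *v x + B *v y"
  by (simp add: vec_eq_iff matrix_vector_mult_def hcat_def vstack_def UNIV_Plus_UNIV[symmetric]
      sum.Plus del: UNIV_Plus_UNIV)

lemma infnorm_vstack_le_iff: "infnorm (vstack x y) \<le> c \<longleftrightarrow> infnorm x \<le> c \<and> infnorm y \<le> c"
  by (simp add: infnorm_le_iff_cart vstack_def split_sum_all)

section \<open>The activation functions\<close>

lemma sigmoid_mono: "x \<le> y \<Longrightarrow> sigmoid x \<le> sigmoid y"
  unfolding sigmoid_def by (intro divide_left_mono) (auto intro!: add_pos_pos mult_pos_pos)

lemma sigmoid_pos: "0 < sigmoid x"
  and sigmoid_less_one: "sigmoid x < 1"
  unfolding sigmoid_def by (simp_all add: add_pos_pos)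

lemma sigmoid_minus: "sigmoid (- x) = 1 - sigmoid x"
proof -
  have "1 + exp x \<noteq> 0" by (metis add_pos_pos exp_gt_zero less_irrefl zero_less_one)
  then show ?thesis by (simp add: sigmoid_def exp_minus divide_simps)
qed

lemma abs_tanh_le_abs: "\<bar>tanh x\<bar> \<le> \<bar>x\<bar>" for x :: real
proof -
  have *: "tanh y \<le> y" if "0 \<le> y" for y :: real
  proof -
    have "((\<lambda>x. x - tanh x) has_real_derivative tanh x ^ 2) (at x)" for x :: real
      by (auto intro!: derivative_eq_intros)
    then have "0 - tanh 0 \<le> y - tanh y"
      using that DERIV_nonneg_imp_nondecreasing[of 0 y "\<lambda>x. x - tanh x"] by fastforce
    then show ?thesis by simp
  qed
  show ?thesis using *[of "\<bar>x\<bar>"] by (simp add: tanh_real_abs)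
qed

section \<open>The MGU layer\<close>

lemma mgu_gate_bounds:
  fixes W\<^sub>f :: "real ^ 'm ^ 'n"
  assumes "infnorm h \<le> 1" "infnorm u \<le> 1"
  shows "mgu_gate W\<^sub>f R\<^sub>f b\<^sub>f h u $ i \<in> {1 - sigma_bar_f W\<^sub>f R\<^sub>f b\<^sub>f .. sigma_bar_f W\<^sub>f R\<^sub>f b\<^sub>f}"
proof -
  let ?A = "hcat (hcat W\<^sub>f R\<^sub>f) (columnvector b\<^sub>f :: real ^ 1 ^ 'n)"
  let ?v = "vstack (vstack u h) (1 :: real ^ 1)"
  define z where "z = (W\<^sub>f *v u + R\<^sub>f *v h + b\<^sub>f) $ i"
  have "infnorm ?v \<le> 1"
    using assms by (simp add: infnorm_vstack_le_iff) (simp add: infnorm_le_iff_cart)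
  moreover have "columnvector b\<^sub>f *v (1 :: real ^ 1) = b\<^sub>f"
    by (simp add: vec_eq_iff matrix_vector_mult_def columnvector_def)
  ultimately have "\<bar>z\<bar> \<le> mat_infnorm ?A"
    using matrix_vector_component_le[of ?v 1 ?A i] by (simp add: z_def hcat_mult_vstack)
  then have "sigmoid (- mat_infnorm ?A) \<le> sigmoid z" "sigmoid z \<le> sigmoid (mat_infnorm ?A)"
    by (auto intro!: sigmoid_mono)
  then show ?thesis
    by (simp add: mgu_gate_def sigma_bar_f_def z_def sigmoid_minus)
qed

lemma mgu_candidate_component_le:
  assumes f: "\<And>j. 0 \<le> f $ j" "\<And>j. f $ j \<le> s" and h: "infnorm h \<le> H"
  shows "\<bar>mgu_candidate W\<^sub>h R\<^sub>h b\<^sub>h f h u $ i\<bar>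
    \<le> s * mat_infnorm R\<^sub>h * H + (mat_infnorm W\<^sub>h * infnorm u + infnorm b\<^sub>h)"
proof -
  have "\<bar>(f * h) $ j\<bar> \<le> s * H" for j
    using f[of j] h by (auto simp: abs_mult infnorm_le_iff_cart intro!: mult_mono)
  then have "infnorm (f * h) \<le> s * H"
    by (simp add: infnorm_le_iff_cart)
  note bounds = matrix_vector_component_le[OF this, of R\<^sub>h i]
    matrix_vector_component_le[OF order_refl, of W\<^sub>h u i] component_le_infnorm_cart[of b\<^sub>h i]
  have "\<bar>mgu_candidate W\<^sub>h R\<^sub>h b\<^sub>h f h u $ i\<bar> \<le> \<bar>(W\<^sub>h *v u + R\<^sub>h *v (f * h) + b\<^sub>h) $ i\<bar>"
    by (simp add: mgu_candidate_def abs_tanh_le_abs del: vector_add_component)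
  also have "\<dots> \<le> mat_infnorm R\<^sub>h * (s * H) + mat_infnorm W\<^sub>h * infnorm u + infnorm b\<^sub>h"
    using bounds by simp
  finally show ?thesis by (simp add: mult_ac)
qed

lemma mgu_step_component_le:
  fixes W\<^sub>f W\<^sub>h :: "real ^ 'm ^ 'n" and R\<^sub>f R\<^sub>h :: "real ^ 'n ^ 'n" and b\<^sub>f b\<^sub>h :: "real ^ 'n"
  assumes h: "infnorm h \<le> H"
    and c: "\<bar>mgu_candidate W\<^sub>h R\<^sub>h b\<^sub>h (mgu_gate W\<^sub>f R\<^sub>f b\<^sub>f h u) h u $ i\<bar> \<le> C"
  defines "f \<equiv> mgu_gate W\<^sub>f R\<^sub>f b\<^sub>f h u $ i"
  shows "\<bar>mgu_step W\<^sub>f W\<^sub>h R\<^sub>f R\<^sub>h b\<^sub>f b\<^sub>h h u $ i\<bar> \<le> (1 - f) * H + f * C"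
proof -
  have f: "0 \<le> f" "f \<le> 1"
    using sigmoid_pos sigmoid_less_one by (simp_all add: f_def mgu_gate_def less_imp_le)
  have hi: "\<bar>h $ i\<bar> \<le> H" using h by (simp add: infnorm_le_iff_cart)
  have "\<bar>mgu_step W\<^sub>f W\<^sub>h R\<^sub>f R\<^sub>h b\<^sub>f b\<^sub>h h u $ i\<bar>
      \<le> \<bar>(1 - f) * h $ i\<bar> + \<bar>f * mgu_candidate W\<^sub>h R\<^sub>h b\<^sub>h (mgu_gate W\<^sub>f R\<^sub>f b\<^sub>f h u) h u $ i\<bar>"
    unfolding mgu_step_def Let_def f_def by simp
  also have "\<dots> \<le> (1 - f) * H + f * C"
    unfolding abs_mult using f hi c by (intro add_mono mult_mono) auto
  finally show ?thesis .
qed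

lemma mgu_step_invariant:
  fixes W\<^sub>f W\<^sub>h :: "real ^ 'm ^ 'n" and R\<^sub>f R\<^sub>h :: "real ^ 'n ^ 'n" and b\<^sub>f b\<^sub>h :: "real ^ 'n"
  shows "forward_invariant (mgu_step W\<^sub>f W\<^sub>h R\<^sub>f R\<^sub>h b\<^sub>f b\<^sub>h) (cbox (- 1) 1) U"
proof -
  have "\<bar>mgu_step W\<^sub>f W\<^sub>h R\<^sub>f R\<^sub>h b\<^sub>f b\<^sub>h h u $ i\<bar> \<le> 1" if "infnorm h \<le> 1" for h u i
  proof -
    have "\<bar>mgu_candidate W\<^sub>h R\<^sub>h b\<^sub>h (mgu_gate W\<^sub>f R\<^sub>f b\<^sub>f h u) h u $ i\<bar> \<le> 1"
      using tanh_real_bounds by (simp add: mgu_candidate_def abs_le_iff less_imp_le minus_le_iff)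
    from mgu_step_component_le[OF that this] show ?thesis by simp
  qed
  then show ?thesis
    by (simp add: forward_invariant_def mem_unit_cbox_iff infnorm_le_iff_cart)
qed

text \<open>
  The condition on \<open>D\<close> says that a state norm of \<open>D\<close> makes the bound on the candidate at most
  \<open>D\<close>. The maximum with \<open>D\<close> is needed because below the level the state may grow towards it.
\<close>

lemma mgu_step_contracts:
  fixes W\<^sub>f W\<^sub>h :: "real ^ 'm ^ 'n" and R\<^sub>f R\<^sub>h :: "real ^ 'n ^ 'n" and b\<^sub>f b\<^sub>h :: "real ^ 'n"
  assumes h: "infnorm h \<le> 1" and u: "infnorm u \<le> 1"
  defines "s \<equiv> sigma_bar_f W\<^sub>f R\<^sub>f b\<^sub>f"
  defines "r \<equiv> s * mat_infnorm R\<^sub>h"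
  defines "l \<equiv> 1 - (1 - s) * (1 - r)"
  assumes r: "r < 1"
    and D: "mat_infnorm W\<^sub>h * infnorm u + infnorm b\<^sub>h \<le> (1 - r) * D"
  shows "infnorm (mgu_step W\<^sub>f W\<^sub>h R\<^sub>f R\<^sub>h b\<^sub>f b\<^sub>h h u) \<le> l * max (infnorm h) D + (1 - l) * D"
  unfolding infnorm_le_iff_cart
proof
  fix i
  define H where "H = max (infnorm h) D"
  let ?f = "mgu_gate W\<^sub>f R\<^sub>f b\<^sub>f h u"
  have f: "1 - s \<le> ?f $ j" "?f $ j \<le> s" for j
    using mgu_gate_bounds[OF h u] by (simp_all add: s_def)
  have f0: "0 \<le> ?f $ j" for j
    by (simp add: mgu_gate_def sigmoid_pos less_imp_le)
  have "\<bar>mgu_candidate W\<^sub>h R\<^sub>h b\<^sub>h ?f h u $ i\<bar> \<le> r * H + (1 - r) * D"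
    using mgu_candidate_component_le[OF f0 f(2), of h H W\<^sub>h R\<^sub>h b\<^sub>h u i] D
    by (simp add: H_def r_def)
  then have "\<bar>mgu_step W\<^sub>f W\<^sub>h R\<^sub>f R\<^sub>h b\<^sub>f b\<^sub>h h u $ i\<bar>
      \<le> (1 - ?f $ i) * H + ?f $ i * (r * H + (1 - r) * D)"
    by (intro mgu_step_component_le) (simp_all add: H_def)
  also have "\<dots> = H - ?f $ i * ((1 - r) * (H - D))"
    by (simp add: algebra_simps)
  also have "\<dots> \<le> H - (1 - s) * ((1 - r) * (H - D))"
    using f(1)[of i] r by (intro diff_left_mono mult_right_mono) (auto simp: H_def)
  also have "\<dots> = l * H + (1 - l) * D"
    by (simp add: l_def algebra_simps)
  finally show "\<bar>mgu_step W\<^sub>f W\<^sub>h R\<^sub>f R\<^sub>h b\<^sub>f b\<^sub>h h u $ i\<bar> \<le> l * max (infnorm h) D + (1 - l) * D"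
    by (simp add: H_def)
qed

theorem theorem1:
  fixes W\<^sub>f W\<^sub>h :: "real ^ 'm ^ 'n"
    and R\<^sub>f R\<^sub>h :: "real ^ 'n ^ 'n"
    and b\<^sub>f :: "real ^ 'n"
  assumes "sigma_bar_f W\<^sub>f R\<^sub>f b\<^sub>f * mat_infnorm R\<^sub>h < 1"
  shows "ISS (mgu_step W\<^sub>f W\<^sub>h R\<^sub>f R\<^sub>h b\<^sub>f)
           (cbox (- 1) 1 :: (real ^ 'n) set) (cbox (- 1) 1 :: (real ^ 'm) set)"
proof -
  define s where "s = sigma_bar_f W\<^sub>f R\<^sub>f b\<^sub>f"
  define r where "r = s * mat_infnorm R\<^sub>h"
  define l where "l = 1 - (1 - s) * (1 - r)"
  have s: "0 < s" "s < 1"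
    by (simp_all add: s_def sigma_bar_f_def sigmoid_pos sigmoid_less_one)
  have r: "0 \<le> r" "r < 1"
    using assms s by (simp_all add: r_def s_def mat_infnorm_nonneg)
  have l: "0 < l" "l < 1"
  proof -
    have "(1 - s) * (1 - r) \<le> 1 - s" using s r by (simp add: mult_left_le)
    then show "0 < l" using s unfolding l_def by linarith
    show "l < 1" using s r by (simp add: l_def)
  qed
  \<comment> \<open>The summand 1 keeps the input gain strictly increasing when \<open>W\<^sub>h = 0\<close>.\<close>
  define cu where "cu = (mat_infnorm W\<^sub>h + 1) / (1 - r)"
  define cb where "cb = 1 / (1 - r)"
  have pos: "0 < cu" "0 < cb"
    using r mat_infnorm_nonneg[of W\<^sub>h] by (simp_all add: cu_def cb_def add_nonneg_pos)
  show ?thesis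
  proof (rule ISS_if_contracts_to_linear_level[OF _ _ mgu_step_invariant l pos])
    fix b h :: "real ^ 'n" and u :: "real ^ 'm" and D
    assume hu: "h \<in> cbox (- 1) 1" "u \<in> cbox (- 1) 1"
      and "D = cu * infnorm u + cb * infnorm b"
    then have "(1 - r) * D = (mat_infnorm W\<^sub>h + 1) * infnorm u + infnorm b"
      using r by (simp add: cu_def cb_def distrib_left)
    then have "mat_infnorm W\<^sub>h * infnorm u + infnorm b \<le> (1 - r) * D"
      using infnorm_pos_le[of u] by (simp add: algebra_simps)
    then show "infnorm (mgu_step W\<^sub>f W\<^sub>h R\<^sub>f R\<^sub>h b\<^sub>f b h u) \<le> l * max (infnorm h) D + (1 - l) * D"
      using mgu_step_contracts[of h u W\<^sub>f R\<^sub>f b\<^sub>f R\<^sub>h W\<^sub>h b D] hu r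
      by (simp add: mem_unit_cbox_iff l_def r_def s_def)
  qed (rule compact_cbox)+
qed

end
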